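(* Let $\alpha,z$ be independent Haar-random elements of $\mathbf{Z}_2$ and $y$ an independent Haar-random element of $\mathbf{Z}_2^\times$, and let $k\ge0$ be an integer. Then: (1) $\Pr\big(v_2(\alpha^2+4yz)=k,\ \mathsf{sqf}(\alpha^2+4yz)\equiv1\pmod8\big)=\Pr\big(v_2(\alpha^2+4yz)=k,\ \mathsf{sqf}(\alpha^2+4yz)\equiv5\pmod8\big)$, and this common value is $0$ if $k$ is odd and $2^{-(k+2)}$ if $k$ is even; (2) $\Pr\big(v_2(\alpha^2+4yz)=k,\ \mathsf{sqf}(\alpha^2+4yz)\equiv3\pmod4\big)$ is $0$ if $k$ is odd or $k=0$, and $2^{-(k+1)}$ if $k\ge2$ is even; (3) $\Pr\big(v_2(\alpha^2+4yz)=k,\ \mathsf{sqf}(\alpha^2+4yz)\equiv2\pmod4\big)$ is $0$ if $k$ is even or $k=1$, and $2^{-k}$ if $k\ge3$ is odd.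
   Context: For nonzero $\beta\in\mathbf{Z}_2$ write $\beta=2^{v}u$ with $v=v_2(\beta)$, $u\in\mathbf{Z}_2^\times$. The condition $\mathsf{sqf}(\beta)\equiv i\pmod 8$ for odd $i$ means $v$ even and $u\equiv i\pmod8$; $\mathsf{sqf}(\beta)\equiv3\pmod4$ means $v$ even and $u\equiv3\pmod4$; $\mathsf{sqf}(\beta)\equiv2\pmod4$ means $v$ odd. (Here $\mathsf{sqf}(\beta)=2^{v\bmod 2}u$ is the squarefree part, defined up to unit squares; $\alpha^2+4yz\neq0$ almost surely.) *)

theory Defs
  imports "HOL-Probability.Probability" "HOL-Number_Theory.Cong"
begin

text \<open>
  The ring of 2-adic integers is the inverse limit of the rings of integers modulo \<open>2 ^ n\<close>;
  the \<open>n\<close>-th component is the least nonnegative representative of the residue modulo \<open>2 ^ n\<close>.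
\<close>

typedef two_adic =
  "{x :: nat \<Rightarrow> int. \<forall>n. 0 \<le> x n \<and> x n < 2 ^ n \<and> x (Suc n) mod 2 ^ n = x n}"
  morphisms residue Abs_two_adic
  by (rule exI[of _ "\<lambda>_. 0"]) simp

setup_lifting type_definition_two_adic

lemma residue_bounds: "0 \<le> residue x n" "residue x n < 2 ^ n"
  and residue_Suc: "residue x (Suc n) mod 2 ^ n = residue x n"
  using residue[of x] by auto

lemma residue_mod [simp]: "residue x n mod 2 ^ n = residue x n"
  using residue_bounds[of x n] by simp

lemma residue_mod_le: "m \<le> n \<Longrightarrow> residue x n mod 2 ^ m = residue x m"
proof (induction n rule: dec_induct)
  case (step n)
  have "residue x (Suc n) mod 2 ^ m = residue x (Suc n) mod 2 ^ n mod 2 ^ m"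
    using step.hyps by (simp add: mod_mod_cancel le_imp_power_dvd)
  then show ?case using step by (simp add: residue_Suc)
qed simp

lemma residue_0 [simp]: "residue x 0 = 0"
  using residue_bounds[of x 0] by simp

lemma two_adic_eqI: "(\<And>n. residue x n = residue y n) \<Longrightarrow> x = y"
  by (simp add: residue_inject[symmetric] fun_eq_iff)

lemma mod_Suc_power_mod: "(a :: int) mod 2 ^ Suc n mod 2 ^ n = a mod 2 ^ n"
  by (simp add: mod_mod_cancel)

instantiation two_adic :: comm_ring_1
begin

lift_definition zero_two_adic :: two_adic is "\<lambda>_. 0" by simp
lift_definition one_two_adic :: two_adic is "\<lambda>n. 1 mod 2 ^ n"
  by (auto simp: mod_Suc_power_mod simp del: power_Suc)
lift_definition plus_two_adic :: "two_adic \<Rightarrow> two_adic \<Rightarrow> two_adic"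
  is "\<lambda>x y n. (x n + y n) mod 2 ^ n"
  by (auto simp: mod_Suc_power_mod simp del: power_Suc) (metis mod_add_eq mod_mod_trivial)
lift_definition minus_two_adic :: "two_adic \<Rightarrow> two_adic \<Rightarrow> two_adic"
  is "\<lambda>x y n. (x n - y n) mod 2 ^ n"
  by (auto simp: mod_Suc_power_mod simp del: power_Suc) (metis mod_diff_eq mod_mod_trivial)
lift_definition uminus_two_adic :: "two_adic \<Rightarrow> two_adic" is "\<lambda>x n. (- x n) mod 2 ^ n"
  by (auto simp: mod_Suc_power_mod simp del: power_Suc) (metis mod_minus_eq mod_mod_trivial)
lift_definition times_two_adic :: "two_adic \<Rightarrow> two_adic \<Rightarrow> two_adic"
  is "\<lambda>x y n. (x n * y n) mod 2 ^ n"
  by (auto simp: mod_Suc_power_mod simp del: power_Suc) (metis mod_mult_eq mod_mod_trivial)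

instance
proof
  fix a b c :: two_adic
  show "a * b * c = a * (b * c)"
    by transfer (simp add: mod_mult_left_eq mod_mult_right_eq mult.assoc)
  show "a * b = b * a" by transfer (simp add: mult.commute)
  show "1 * a = a" by (rule two_adic_eqI) (simp add: times_two_adic.rep_eq one_two_adic.rep_eq mod_mult_left_eq)
  show "(a + b) + c = a + (b + c)"
    by transfer (simp add: mod_add_left_eq mod_add_right_eq add.assoc)
  show "a + b = b + a" by transfer (simp add: add.commute)
  show "0 + a = a" by (rule two_adic_eqI) (simp add: plus_two_adic.rep_eq zero_two_adic.rep_eq)
  show "- a + a = 0"
    by (rule two_adic_eqI) (simp add: plus_two_adic.rep_eq uminus_two_adic.rep_eq zero_two_adic.rep_eq mod_add_left_eq)
  show "a - b = a + - b"
    by (rule two_adic_eqI) (simp add: plus_two_adic.rep_eq uminus_two_adic.rep_eq minus_two_adic.rep_eq mod_add_right_eq)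
  show "(a + b) * c = a * c + b * c"
    by transfer (simp add: mod_mult_left_eq mod_add_left_eq mod_add_right_eq distrib_right)
  have "residue (0::two_adic) 1 \<noteq> residue (1::two_adic) 1"
    by (simp add: zero_two_adic.rep_eq one_two_adic.rep_eq)
  then show "(0::two_adic) \<noteq> 1" by metis
qed

end

lemma residue_of_int: "residue (of_int k) n = k mod 2 ^ n"
proof -
  have nat: "residue (of_nat m) n = int m mod 2 ^ n" for m
    by (induction m)
      (simp_all only: of_nat_0 of_nat_Suc zero_two_adic.rep_eq one_two_adic.rep_eq
        plus_two_adic.rep_eq mod_add_eq, simp_all)
  show ?thesis
    by (cases k rule: int_cases2)
      (simp_all add: nat uminus_two_adic.rep_eq mod_minus_eq)
qed

lemma residue_numeral: "residue (numeral k) n = numeral k mod 2 ^ n"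
  using residue_of_int[of "numeral k" n] by simp

lemma residue_two_power: "residue (2 ^ k) n = 2 ^ k mod 2 ^ n"
  using residue_of_int[of "2 ^ k" n] by simp

lemma two_power_dvd_iff: "2 ^ n dvd x \<longleftrightarrow> residue x n = 0"
proof
  assume "2 ^ n dvd x"
  then obtain y where "x = 2 ^ n * y" by blast
  then show "residue x n = 0" by (simp add: times_two_adic.rep_eq residue_two_power)
next
  assume 0: "residue x n = 0"
  define y where "y = (\<lambda>m. residue x (m + n) div 2 ^ n)"
  have dvd: "2 ^ n dvd residue x (m + n)" for m
    using residue_mod_le[of n "m + n" x] 0 by auto
  have *: "residue x (m + n) = 2 ^ n * y m" for m using dvd by (simp add: y_def)
  have "0 \<le> y m \<and> y m < 2 ^ m \<and> y (Suc m) mod 2 ^ m = y m" for m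
  proof -
    have "2 ^ n * y m < 2 ^ n * 2 ^ m"
      using residue_bounds(2)[of x "m + n"] by (simp only: * power_add mult.commute[of "2 ^ m"])
    moreover have "2 ^ n * (y (Suc m) mod 2 ^ m) = 2 ^ n * y m"
    proof -
      have "2 ^ n * (y (Suc m) mod 2 ^ m) = 2 ^ n * y (Suc m) mod (2 ^ n * 2 ^ m)"
        by (rule mult_mod_right)
      also have "\<dots> = residue x (Suc (m + n)) mod 2 ^ (m + n)"
        using *[of "Suc m"] by (simp only: power_add mult.commute[of "2 ^ m"] add_Suc)
      finally show ?thesis by (simp only: residue_Suc *)
    qed
    moreover have "0 \<le> y m"
      using residue_bounds(1)[of x "m + n"] by (simp add: y_def pos_imp_zdiv_nonneg_iff)
    ultimately show ?thesis by simp
  qed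
  then have y: "residue (Abs_two_adic y) = y" by (simp add: Abs_two_adic_inverse)
  have "x = 2 ^ n * Abs_two_adic y"
  proof (rule two_adic_eqI)
    fix m
    show "residue x m = residue (2 ^ n * Abs_two_adic y) m"
      using *[of m] residue_mod_le[of m "m + n" x]
      by (simp add: times_two_adic.rep_eq residue_two_power y mod_mult_left_eq)
  qed
  then show "2 ^ n dvd x" by simp
qed

lemma two_adic_nonzeroE:
  assumes "x \<noteq> (0 :: two_adic)"
  obtains n where "residue x n \<noteq> 0"
  using assms two_adic_eqI[of x 0] by (auto simp: zero_two_adic.rep_eq)

instance two_adic :: idom
proof
  fix x y :: two_adic
  assume "x \<noteq> 0" "y \<noteq> 0"
  then obtain n m where nm: "residue x n \<noteq> 0" "residue y m \<noteq> 0" by (metis two_adic_nonzeroE)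
  let ?N = "n + m"
  define a b where "a = residue x ?N" and "b = residue y ?N"
  have a: "\<not> 2 ^ n dvd a" using nm residue_mod_le[of n ?N x] by (auto simp: a_def)
  have b: "\<not> 2 ^ m dvd b" using nm residue_mod_le[of m ?N y] by (auto simp: b_def)
  have "a \<noteq> 0" "b \<noteq> 0" using a b by auto
  have "multiplicity 2 a < n" "multiplicity 2 b < m"
    using a b \<open>a \<noteq> 0\<close> \<open>b \<noteq> 0\<close>
    by (meson multiplicity_dvd' not_le)+
  then have "multiplicity 2 (a * b) < ?N"
    using \<open>a \<noteq> 0\<close> \<open>b \<noteq> 0\<close> by (subst prime_elem_multiplicity_mult_distrib) auto
  then have "\<not> 2 ^ ?N dvd a * b"
    using \<open>a \<noteq> 0\<close> \<open>b \<noteq> 0\<close> power_dvd_iff_le_multiplicity[of "a * b" 2 ?N] by auto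
  then have "residue (x * y) ?N \<noteq> 0"
    by (auto simp: times_two_adic.rep_eq a_def b_def)
  then show "x * y \<noteq> 0" by (auto simp: zero_two_adic.rep_eq)
qed

lemma two_adic_is_unit_iff: "(u :: two_adic) dvd 1 \<longleftrightarrow> \<not> 2 dvd u"
proof
  assume "u dvd 1"
  moreover have "\<not> 2 dvd (1 :: two_adic)"
    using two_power_dvd_iff[of 1 1] by (simp add: one_two_adic.rep_eq)
  ultimately show "\<not> 2 dvd u" using dvd_trans by blast
next
  assume "\<not> 2 dvd u"
  then have "residue u 1 \<noteq> 0" using two_power_dvd_iff[of 1 u] by simp
  then have coprime: "coprime (residue u n) (2 ^ n)" for n
  proof (cases "n = 0")
    case False
    then have "residue u n mod 2 = residue u 1" using residue_mod_le[of 1 n u] by simp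
    then have "odd (residue u n)" using \<open>residue u 1 \<noteq> 0\<close> by auto
    then show ?thesis by (simp add: coprime_right_2_iff_odd)
  qed simp
  then have "\<exists>b. [residue u n * b = 1] (mod 2 ^ n)" for n by (rule cong_solve_coprime_int)
  then obtain f where f: "\<And>n. [residue u n * f n = 1] (mod 2 ^ n)" by metis
  define g where "g = (\<lambda>n. f n mod 2 ^ n)"
  have g: "[residue u n * g n = 1] (mod 2 ^ n)" for n
    using f[of n] by (simp add: g_def cong_def mod_mult_right_eq)
  have "g (Suc n) mod 2 ^ n = g n" for n
  proof -
    have "[residue u (Suc n) * g (Suc n) = 1] (mod 2 ^ n)"
      using g[of "Suc n"] by (rule cong_dvd_modulus) simp
    moreover have "[residue u (Suc n) = residue u n] (mod 2 ^ n)"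
      by (simp add: cong_def residue_Suc)
    ultimately have "[residue u n * g (Suc n) = 1] (mod 2 ^ n)"
      by (meson cong_scalar_right cong_sym cong_trans)
    then have "[residue u n * g (Suc n) = residue u n * g n] (mod 2 ^ n)"
      using g[of n] by (meson cong_sym cong_trans)
    then have "[g (Suc n) = g n] (mod 2 ^ n)"
      using coprime[of n] by (simp add: cong_mult_lcancel)
    then show ?thesis by (simp add: cong_def g_def)
  qed
  then have "residue (Abs_two_adic g) = g"
    by (intro Abs_two_adic_inverse) (simp add: g_def)
  then have "u * Abs_two_adic g = 1"
    using g by (intro two_adic_eqI) (simp add: times_two_adic.rep_eq one_two_adic.rep_eq cong_def)
  then show "u dvd 1" by (metis dvd_triv_left)
qed

lemma finite_two_power_dvd:
  assumes "x \<noteq> (0 :: two_adic)"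
  shows "finite {n. 2 ^ n dvd x}"
proof -
  obtain m where m: "residue x m \<noteq> 0" using assms by (rule two_adic_nonzeroE)
  have "n < m" if "2 ^ n dvd x" for n
  proof (rule ccontr)
    assume "\<not> n < m"
    then have "2 ^ m dvd x" using that by (meson le_imp_power_dvd dvd_trans not_less)
    then show False using m by (simp add: two_power_dvd_iff)
  qed
  then have "{n. 2 ^ n dvd x} \<subseteq> {..<m}" by blast
  then show ?thesis by (rule finite_subset) simp
qed

text \<open>
  Division is total: it is exact whenever possible and \<open>0\<close> otherwise.  With the normalisation
  \<open>normalize x = 2 ^ v\<close>, \<open>unit_factor x = u\<close> for \<open>x = 2 ^ v * u \<noteq> 0\<close>, the library function
  \<open>multiplicity 2\<close> becomes the 2-adic valuation of nonzero elements (at \<open>0\<close> it has the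
  value \<open>0\<close>, not infinity).
\<close>

instantiation two_adic :: normalization_semidom
begin

definition divide_two_adic :: "two_adic \<Rightarrow> two_adic \<Rightarrow> two_adic" where
  "divide_two_adic a b = (if b \<noteq> 0 \<and> b dvd a then THE c. a = c * b else 0)"

definition normalize_two_adic :: "two_adic \<Rightarrow> two_adic" where
  "normalize_two_adic x = (if x = 0 then 0 else 2 ^ Max {n. 2 ^ n dvd x})"

definition unit_factor_two_adic :: "two_adic \<Rightarrow> two_adic" where
  "unit_factor_two_adic x = (if x = 0 then 0 else x div 2 ^ Max {n. 2 ^ n dvd x})"

instance
proof
  fix a b :: two_adic
  have two: "(2 :: two_adic) ^ n \<noteq> 0" for n
  proof -
    have "residue (2 ^ n) (Suc n) \<noteq> 0" by (simp add: residue_two_power)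
    then show ?thesis by (metis zero_two_adic.rep_eq)
  qed
  have div: "(a * b) div b = a" if "b \<noteq> 0" for a b :: two_adic
    using that by (auto simp: divide_two_adic_def)
  then show "(a * b) div b = a" if "b \<noteq> 0" using that .
  show "a div 0 = 0" by (simp add: divide_two_adic_def)
  show "unit_factor (0 :: two_adic) = 0" "normalize (0 :: two_adic) = 0"
    by (simp_all add: unit_factor_two_adic_def normalize_two_adic_def)
  have max: "2 ^ Max {n. 2 ^ n dvd x} dvd x" if "x \<noteq> 0" for x :: two_adic
  proof -
    have "0 \<in> {n. 2 ^ n dvd x}" by simp
    then have "Max {n. 2 ^ n dvd x} \<in> {n. 2 ^ n dvd x}"
      by (intro Max_in finite_two_power_dvd that) blast
    then show ?thesis by simp
  qed
  show prod: "unit_factor x * normalize x = x" for x :: two_adic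
  proof (cases "x = 0")
    case False
    define m where "m = Max {n. 2 ^ n dvd x}"
    obtain c where c: "x = 2 ^ m * c" using max[OF False] unfolding m_def by (rule dvdE)
    then have "x div 2 ^ m = c" using div[OF two, of c m] by (simp add: mult.commute)
    then have "unit_factor x = c" "normalize x = 2 ^ m"
      using False by (simp_all only: unit_factor_two_adic_def normalize_two_adic_def m_def if_False)
    then show ?thesis using c by (simp only: mult.commute)
  qed (simp add: unit_factor_two_adic_def)
  show "unit_factor x dvd 1" if "x \<noteq> 0" for x :: two_adic
    unfolding two_adic_is_unit_iff
  proof
    let ?m = "Max {n. 2 ^ n dvd x}"
    assume "2 dvd unit_factor x"
    then have "2 * 2 ^ ?m dvd unit_factor x * normalize x"
      using that by (intro mult_dvd_mono) (simp_all add: normalize_two_adic_def)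
    then have "2 ^ Suc ?m dvd x" by (simp add: prod)
    then have "Suc ?m \<le> ?m" using Max_ge[OF finite_two_power_dvd[OF that]] by blast
    then show False by simp
  qed
  show mult: "unit_factor (a * b) = a * unit_factor b" if unit: "a dvd 1" for a b :: two_adic
  proof (cases "b = 0")
    case False
    obtain a' where a': "1 = a * a'" using unit by (rule dvdE)
    have "a' * (a * b) = (a * a') * b" by (simp add: algebra_simps)
    then have inv: "a' * (a * b) = b" by (simp only: a'[symmetric] mult_1_left)
    have "a \<noteq> 0" using a' by (metis mult_zero_left zero_neq_one)
    have iff: "2 ^ n dvd a * b \<longleftrightarrow> 2 ^ n dvd b" for n
    proof
      assume "2 ^ n dvd a * b"
      then have "2 ^ n dvd a' * (a * b)" by (rule dvd_mult)
      then show "2 ^ n dvd b" by (simp only: inv)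
    qed (rule dvd_mult)
    then have norm: "normalize (a * b) = normalize b"
      using False \<open>a \<noteq> 0\<close> by (simp add: normalize_two_adic_def)
    have "unit_factor (a * b) * normalize b = (a * unit_factor b) * normalize b"
      using prod[of "a * b"] prod[of b] by (simp add: norm mult.assoc)
    moreover have "normalize b \<noteq> 0" using False two by (simp add: normalize_two_adic_def)
    ultimately show ?thesis by simp
  qed (simp add: unit_factor_two_adic_def)
  show "unit_factor a = a" if "a dvd 1" for a :: two_adic
  proof -
    have "{n. 2 ^ n dvd (1 :: two_adic)} = {0}"
    proof -
      have "n = 0" if "2 ^ n dvd (1 :: two_adic)" for n
      proof (rule ccontr)
        assume "n \<noteq> 0"
        then have "2 dvd (1 :: two_adic)" using that by (metis dvd_power dvd_trans neq0_conv)
        then show False using two_adic_is_unit_iff[of 1] by simp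
      qed
      then show ?thesis by auto
    qed
    then have "normalize (1 :: two_adic) = 1" by (simp add: normalize_two_adic_def)
    then have "unit_factor (1 :: two_adic) = 1" using prod[of 1] by simp
    then show ?thesis using mult[OF that, of 1] by simp
  qed
qed

end

lemma two_adic_prime_elem_2: "prime_elem (2 :: two_adic)"
proof (rule prime_elemI)
  show "(2 :: two_adic) \<noteq> 0"
    using residue_two_power[of 1 2]
    by (auto simp: zero_two_adic.rep_eq)
  show "\<not> is_unit (2 :: two_adic)" by (simp add: two_adic_is_unit_iff)
  show "2 dvd a \<or> 2 dvd b" if "2 dvd a * b" for a b :: two_adic
    using that by (metis two_adic_is_unit_iff is_unit_mult_iff)
qed

instance two_adic :: factorial_semiring
proof
  fix x :: two_adic
  assume "x \<noteq> 0"
  then have "normalize x = 2 ^ Max {n. 2 ^ n dvd x}" by (simp add: normalize_two_adic_def)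
  then have "normalize (\<Prod>\<^sub># (replicate_mset (Max {n. 2 ^ n dvd x}) 2)) = normalize (normalize x)"
    by (simp only: prod_mset_replicate_mset)
  then show "\<exists>A. (\<forall>x. x \<in># A \<longrightarrow> prime_elem x) \<and> normalize (\<Prod>\<^sub># A) = normalize x"
    by (intro exI[of _ "replicate_mset (Max {n. 2 ^ n dvd x}) 2"])
      (use two_adic_prime_elem_2 in \<open>auto simp: in_replicate_mset\<close>)
qed

lemma two_adic_decomp:
  fixes x :: two_adic
  assumes "x \<noteq> 0"
  shows "x = 2 ^ multiplicity 2 x * unit_factor x" "is_unit (unit_factor x)"
proof -
  have "multiplicity 2 x = Max {n. 2 ^ n dvd x}"
    using finite_two_power_dvd[OF assms] by (simp add: multiplicity_def)
  then have "normalize x = 2 ^ multiplicity 2 x" using assms by (simp add: normalize_two_adic_def)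
  then show "x = 2 ^ multiplicity 2 x * unit_factor x"
    by (metis normalize_mult_unit_factor)
  show "is_unit (unit_factor x)" using assms by simp
qed

definition sqf :: "two_adic \<Rightarrow> two_adic" where
  "sqf x = 2 ^ (multiplicity 2 x mod 2) * unit_factor x"

definition adic_cong :: "two_adic \<Rightarrow> two_adic \<Rightarrow> two_adic \<Rightarrow> bool"
  ("(1[_ \<equiv> _] '(modulo _'))") where
  "[a \<equiv> b] (modulo m) \<longleftrightarrow> m dvd a - b"

lemma sqf_odd_cong_iff:
  assumes "x \<noteq> 0" "2 dvd m" "\<not> 2 dvd i"
  shows "[sqf x \<equiv> i] (modulo m) \<longleftrightarrow> even (multiplicity 2 x) \<and> [unit_factor x \<equiv> i] (modulo m)"
proof (cases "even (multiplicity 2 x)")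
  case True
  then show ?thesis by (simp add: sqf_def even_iff_mod_2_eq_zero)
next
  case False
  then have "2 dvd sqf x" by (simp add: sqf_def odd_iff_mod_2_eq_one)
  then have "\<not> m dvd sqf x - i" using assms(2,3)
    by (metis dvd_diff_right_iff dvd_trans)
  then show ?thesis using False by (simp add: adic_cong_def)
qed

lemma sqf_cong_2_mod_4_iff:
  assumes "x \<noteq> 0"
  shows "[sqf x \<equiv> 2] (modulo 4) \<longleftrightarrow> odd (multiplicity 2 x)"
proof -
  have u: "\<not> 2 dvd unit_factor x" using assms two_adic_is_unit_iff by auto
  have 4: "(4 :: two_adic) = 2 * 2" by simp
  show ?thesis
  proof (cases "even (multiplicity 2 x)")
    case True
    then have "sqf x = unit_factor x" by (simp add: sqf_def even_iff_mod_2_eq_zero)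
    then have "\<not> 2 dvd sqf x - 2" using u by (metis dvd_diff_left_iff dvd_refl)
    then show ?thesis using True unfolding adic_cong_def 4 by (meson dvd_mult_left)
  next
    case False
    then have *: "sqf x - 2 = 2 * (unit_factor x - 1)"
      by (simp add: sqf_def odd_iff_mod_2_eq_one algebra_simps)
    have "residue (unit_factor x) 1 \<noteq> 0" using u two_power_dvd_iff[of 1 "unit_factor x"] by simp
    then have "residue (unit_factor x) 1 = 1" using residue_bounds[of "unit_factor x" 1] by simp
    then have "residue (unit_factor x - 1) 1 = 0"
      by (simp add: minus_two_adic.rep_eq one_two_adic.rep_eq)
    then have "2 dvd unit_factor x - 1"
      using two_power_dvd_iff[of 1 "unit_factor x - 1"] by simp
    then have "2 * 2 dvd sqf x - 2" unfolding * by (intro mult_dvd_mono dvd_refl)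
    then show ?thesis using False by (simp only: adic_cong_def 4 not_False_eq_True)
  qed
qed

text \<open>The inverse limit topology: the residue classes modulo powers of two form a basis.\<close>

instantiation two_adic :: topological_space
begin

definition open_two_adic :: "two_adic set \<Rightarrow> bool" where
  "open_two_adic U \<longleftrightarrow> (\<forall>x\<in>U. \<exists>n. {y. residue y n = residue x n} \<subseteq> U)"

instance
proof
  show "open (UNIV :: two_adic set)" by (simp add: open_two_adic_def)
  show "open (S \<inter> T)" if "open S" "open T" for S T :: "two_adic set"
    unfolding open_two_adic_def
  proof
    fix x assume "x \<in> S \<inter> T"
    then obtain n m where nm: "{y. residue y n = residue x n} \<subseteq> S" "{y. residue y m = residue x m} \<subseteq> T"
      using \<open>open S\<close> \<open>open T\<close> unfolding open_two_adic_def by (meson IntD1 IntD2)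
    let ?N = "max n m"
    have "{y. residue y ?N = residue x ?N} \<subseteq> S \<inter> T"
    proof
      fix y assume "y \<in> {y. residue y ?N = residue x ?N}"
      then have eq: "residue y ?N = residue x ?N" by simp
      have "residue y k = residue x k" if "k \<le> ?N" for k
        using residue_mod_le[OF that, of x] residue_mod_le[OF that, of y] by (simp only: eq)
      then have "residue y n = residue x n" "residue y m = residue x m" by simp_all
      then show "y \<in> S \<inter> T" using nm by auto
    qed
    then show "\<exists>n. {y. residue y n = residue x n} \<subseteq> S \<inter> T" by blast
  qed
  show "open (\<Union>K)" if K: "\<forall>S\<in>K. open S" for K :: "two_adic set set"
    unfolding open_two_adic_def
  proof
    fix x assume "x \<in> \<Union>K"
    then obtain S where S: "S \<in> K" "x \<in> S" by blast
    then obtain n where "{y. residue y n = residue x n} \<subseteq> S"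
      using K unfolding open_two_adic_def by meson
    then show "\<exists>n. {y. residue y n = residue x n} \<subseteq> \<Union>K" using S by blast
  qed
qed

end

text \<open>
  Haar probability measure of the compact abelian group \<open>S\<close> (a subset of the type \<open>'a\<close> with the
  induced topology) with group operation \<open>f\<close>: the invariant Borel probability measure.  It is used
  for the additive group of 2-adic integers and for its multiplicative group of units; as these
  spaces are compact and second countable, regularity is automatic.
\<close>

definition haar_prob :: "'a::topological_space set \<Rightarrow> ('a \<Rightarrow> 'a \<Rightarrow> 'a) \<Rightarrow> 'a measure \<Rightarrow> bool" where
  "haar_prob S f \<mu> \<longleftrightarrow>
     prob_space \<mu> \<and> sets \<mu> = sets (restrict_space borel S) \<and>
     (\<forall>c\<in>S. \<forall>A\<in>sets \<mu>. emeasure \<mu> (f c ` A) = emeasure \<mu> A)"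

definition haar_random ::
  "'w measure \<Rightarrow> 'a::topological_space set \<Rightarrow> ('a \<Rightarrow> 'a \<Rightarrow> 'a) \<Rightarrow> ('w \<Rightarrow> 'a) \<Rightarrow> bool" where
  "haar_random M S f X \<longleftrightarrow>
     X \<in> M \<rightarrow>\<^sub>M restrict_space borel S \<and> haar_prob S f (distr M (restrict_space borel S) X)"

end

theory Submission
  imports Defs
begin

text \<open>
  Everything reduces to residues.  For an odd integer \<open>i\<close>, the conditions \<open>v\<^sub>2(D) = k\<close> and
  \<open>u \<equiv> i (mod 2\<^sup>j)\<close> on \<open>D = 2\<^sup>k u\<close> together say that \<open>D \<equiv> 2\<^sup>k i (mod 2\<^sup>k\<^sup>+\<^sup>j)\<close>.  For fixed \<open>\<alpha>\<close> and fixed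
  unit \<open>y\<close>, the congruence \<open>\<alpha>\<^sup>2 + 4 y z \<equiv> r (mod 2\<^sup>m\<^sup>+\<^sup>2)\<close> has no solution unless \<open>\<alpha>\<^sup>2 \<equiv> r (mod 4)\<close>, in
  which case it prescribes \<open>z\<close> modulo \<open>2\<^sup>m\<close>.  Since \<open>\<alpha>\<^sup>2 \<equiv> r (mod 4)\<close> prescribes the parity of \<open>\<alpha>\<close>
  when \<open>r \<equiv> 0, 1 (mod 4)\<close> and is impossible otherwise, the probability is \<open>2\<^sup>-\<^sup>m\<^sup>-\<^sup>1\<close> or \<open>0\<close>.
\<close>

section \<open>Valuation and squarefree part in terms of residues\<close>

lemma two_power_dvd_diff_of_int_iff:
  "2 ^ n dvd x - of_int c \<longleftrightarrow> residue x n = c mod 2 ^ n"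
proof -
  have "residue (x - of_int c) n = (residue x n - c) mod 2 ^ n"
    by (simp add: minus_two_adic.rep_eq residue_of_int mod_diff_right_eq)
  moreover have "(residue x n - c) mod 2 ^ n = 0 \<longleftrightarrow> residue x n mod 2 ^ n = c mod 2 ^ n"
    by (simp only: mod_eq_dvd_iff mod_eq_0_iff_dvd)
  ultimately show ?thesis
    by (simp add: two_power_dvd_iff)
qed

lemma two_dvd_of_int_iff: "2 dvd (of_int i :: two_adic) \<longleftrightarrow> even i"
  using two_power_dvd_iff[of 1 "of_int i"] by (simp add: residue_of_int even_iff_mod_2_eq_zero)

text \<open>Dividing by \<open>2 ^ k\<close> identifies the two sides: a residue as on the right
  means \<open>x = 2 ^ k * (i + 2 ^ j * t)\<close>. As \<open>i\<close> is odd and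
  \<open>j > 0\<close>, the second factor is a unit, so it is the unit part of \<open>x\<close> and
  \<open>k\<close> is the valuation.\<close>

lemma multiplicity_unit_factor_iff_residue:
  assumes "odd i" "j > 0"
  shows "x \<noteq> 0 \<and> multiplicity 2 x = k \<and> [unit_factor x \<equiv> of_int i] (modulo 2 ^ j) \<longleftrightarrow>
    residue x (k + j) = 2 ^ k * i mod 2 ^ (k + j)"
proof -
  have "x \<noteq> 0 \<and> multiplicity 2 x = k \<and> 2 ^ j dvd unit_factor x - of_int i \<longleftrightarrow>
      2 ^ (k + j) dvd x - of_int (2 ^ k * i)"
  proof
    assume *: "x \<noteq> 0 \<and> multiplicity 2 x = k \<and> 2 ^ j dvd unit_factor x - of_int i"
    then have "x = 2 ^ k * unit_factor x"
      using two_adic_decomp(1)[of x] by simp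
    then have "x - of_int (2 ^ k * i) = 2 ^ k * (unit_factor x - of_int i)"
      by (simp add: right_diff_distrib)
    then show "2 ^ (k + j) dvd x - of_int (2 ^ k * i)"
      using * by (simp add: power_add mult_dvd_mono)
  next
    assume "2 ^ (k + j) dvd x - of_int (2 ^ k * i)"
    then obtain t where t: "x - of_int (2 ^ k * i) = 2 ^ (k + j) * t" ..
    define u where "u = of_int i + 2 ^ j * t"
    have x: "x = 2 ^ k * u"
      using t by (simp add: u_def algebra_simps power_add)
    have "2 dvd (2 :: two_adic) ^ j * t"
      using \<open>j > 0\<close> by simp
    then have u: "\<not> 2 dvd u"
      using \<open>odd i\<close> by (simp add: u_def dvd_add_left_iff two_dvd_of_int_iff)
    have "u \<noteq> 0"
      using u by auto
    moreover have two: "(2 :: two_adic) \<noteq> 0"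
      using two_adic_prime_elem_2 by (rule prime_elem_not_zeroI)
    ultimately have "x \<noteq> 0"
      by (simp add: x)
    have mult: "multiplicity 2 x = k"
      using u two by (intro multiplicity_eqI) (auto simp: x)
    have "2 ^ k * unit_factor x = 2 ^ k * u"
      using two_adic_decomp(1)[OF \<open>x \<noteq> 0\<close>] by (simp only: mult x[symmetric])
    then have "unit_factor x = u"
      using two by simp
    then show "x \<noteq> 0 \<and> multiplicity 2 x = k \<and> 2 ^ j dvd unit_factor x - of_int i"
      using \<open>x \<noteq> 0\<close> mult by (simp add: u_def)
  qed
  then show ?thesis
    unfolding adic_cong_def two_power_dvd_diff_of_int_iff .
qed

text \<open>For odd valuation \<open>sqf x\<close> is even and cannot be congruent to an odd
  \<open>i\<close> modulo an even number; this forces \<open>even k\<close>. For even valuation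
  \<open>sqf x\<close> is the unit part.\<close>

lemma sqf_cong_odd_iff_residue:
  assumes "odd i" "j > 0"
  shows "x \<noteq> 0 \<and> multiplicity 2 x = k \<and> [sqf x \<equiv> of_int i] (modulo 2 ^ j) \<longleftrightarrow>
    even k \<and> residue x (k + j) = 2 ^ k * i mod 2 ^ (k + j)"
proof -
  have "2 dvd (2 :: two_adic) ^ j" "\<not> 2 dvd (of_int i :: two_adic)"
    using assms by (simp_all add: two_dvd_of_int_iff)
  then show ?thesis
    using sqf_odd_cong_iff[of x "2 ^ j" "of_int i"] multiplicity_unit_factor_iff_residue[OF assms, of x k]
    by blast
qed

lemma sqf_cong_2_mod_4_iff_residue:
  "x \<noteq> 0 \<and> multiplicity 2 x = k \<and> [sqf x \<equiv> 2] (modulo 4) \<longleftrightarrow>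
    odd k \<and> residue x (Suc k) = 2 ^ k mod 2 ^ Suc k"
proof -
  \<comment> \<open>Every unit is 1 modulo 2, so prescribing the valuation alone is the case
    \<open>i = 1\<close>, \<open>j = 1\<close> of the criterion for unit parts.\<close>
  have "[unit_factor x \<equiv> of_int 1] (modulo 2 ^ 1)" if "x \<noteq> 0"
  proof -
    have "residue (unit_factor x) 1 \<noteq> 0"
      using that two_power_dvd_iff[of 1 "unit_factor x"] two_adic_is_unit_iff[of "unit_factor x"] by simp
    then have "residue (unit_factor x) 1 = 1"
      using residue_bounds[of "unit_factor x" 1] by simp
    then show ?thesis
      unfolding adic_cong_def two_power_dvd_diff_of_int_iff by simp
  qed
  then show ?thesis
    using multiplicity_unit_factor_iff_residue[of 1 1 x k] sqf_cong_2_mod_4_iff[of x] by auto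
qed

section \<open>Haar measure of residue classes and independence\<close>

lemma open_residue_class: "open {x. residue x n \<in> A}"
  by (auto simp: open_two_adic_def intro!: exI[of _ n])

lemma measurable_residue [measurable]: "(\<lambda>x. residue x n) \<in> borel \<rightarrow>\<^sub>M count_space UNIV"
  by (rule measurableI) (auto simp: vimage_def open_residue_class intro: borel_open)

text \<open>The \<open>2 ^ n\<close> residue classes are translates of one another and partition the
  group, so invariance gives them equal shares of the total mass 1.\<close>

lemma haar_prob_residue_class:
  assumes "haar_prob UNIV (+) \<mu>" "0 \<le> c" "c < 2 ^ n"
  shows "measure \<mu> {x. residue x n = c} = 1 / 2 ^ n"
proof -
  interpret prob_space \<mu>
    using assms by (simp add: haar_prob_def)
  have sets: "sets \<mu> = sets borel"
    using assms by (simp add: haar_prob_def)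
  define V where "V c = {x. residue x n = c}" for c
  have V: "V c \<in> sets \<mu>" for c
    using open_residue_class[of n "{c}"] by (simp add: sets V_def)
  have translate: "(+) (of_int c) ` V 0 = V c" if "0 \<le> c" "c < 2 ^ n" for c
  proof (intro equalityI subsetI)
    fix x assume "x \<in> V c"
    then have "x - of_int c \<in> V 0"
      using that by (simp add: V_def minus_two_adic.rep_eq residue_of_int)
    then show "x \<in> (+) (of_int c) ` V 0"
      by (intro image_eqI[of _ _ "x - of_int c"]) auto
  qed (use that in \<open>auto simp: V_def plus_two_adic.rep_eq residue_of_int\<close>)
  have eq: "measure \<mu> (V c) = measure \<mu> (V 0)" if "0 \<le> c" "c < 2 ^ n" for c
    using assms(1) V[of 0] unfolding haar_prob_def translate[OF that, symmetric] measure_def by simp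
  have "(\<Union>c\<in>{0..<2 ^ n}. V c) = space \<mu>"
    using residue_bounds sets_eq_imp_space_eq[OF sets] by (auto simp: V_def)
  then have "1 = (\<Sum>c\<in>{0..<2 ^ n}. measure \<mu> (V c))"
    using finite_measure_finite_Union[of "{0..<2 ^ n}" V] V
    by (simp add: prob_space image_subset_iff disjoint_family_on_def V_def disjoint_iff)
  also have "\<dots> = (\<Sum>c\<in>{0..<2 ^ n :: int}. measure \<mu> (V 0))"
    by (intro sum.cong) (auto intro: eq)
  finally have "measure \<mu> (V 0) = 1 / 2 ^ n"
    by (simp add: field_simps)
  then show ?thesis
    using eq[of c] assms by (simp add: V_def)
qed

lemma haar_random_residue:
  assumes "haar_random M UNIV (+) X" "0 \<le> c" "c < 2 ^ n"
  shows "measure M {\<omega> \<in> space M. residue (X \<omega>) n = c} = 1 / 2 ^ n"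
proof -
  have "restrict_space borel UNIV = (borel :: two_adic measure)"
    by (simp add: restrict_space_def measure_of_of_measure flip: space_borel)
  then have X: "X \<in> M \<rightarrow>\<^sub>M borel" and haar: "haar_prob UNIV (+) (distr M borel X)"
    using assms by (simp_all add: haar_random_def)
  have "measure M {\<omega> \<in> space M. residue (X \<omega>) n = c} = measure (distr M borel X) {x. residue x n = c}"
    using X open_residue_class[of n "{c}"]
    by (subst measure_distr) (auto intro!: arg_cong[of _ _ "measure M"])
  then show ?thesis
    using haar_prob_residue_class[OF haar] assms by simp
qed

text \<open>Taking one of the sets to be the whole space turns this into the product rule for the
  other two variables.\<close>

lemma (in prob_space) indep_vars_3D:
  assumes "indep_vars (\<lambda>_. N) (\<lambda>i. [X, Y, Z] ! i) {..<3}"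
    and "A \<in> sets N" "B \<in> sets N" "C \<in> sets N"
  shows "prob {\<omega> \<in> space M. X \<omega> \<in> A \<and> Y \<omega> \<in> B \<and> Z \<omega> \<in> C} =
    prob {\<omega> \<in> space M. X \<omega> \<in> A} * prob {\<omega> \<in> space M. Y \<omega> \<in> B} * prob {\<omega> \<in> space M. Z \<omega> \<in> C}"
proof -
  have three: "{..<3} = {0, 1, 2 :: nat}"
    by auto
  have "prob (\<Inter>i\<in>{..<3}. ([X, Y, Z] ! i) -` ([A, B, C] ! i) \<inter> space M) =
      (\<Prod>i\<in>{..<3}. prob (([X, Y, Z] ! i) -` ([A, B, C] ! i) \<inter> space M))"
    using assms by (intro indep_varsD[OF assms(1)]) (auto simp: three)
  moreover have "(\<Inter>i\<in>{..<3}. ([X, Y, Z] ! i) -` ([A, B, C] ! i) \<inter> space M) =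
      {\<omega> \<in> space M. X \<omega> \<in> A \<and> Y \<omega> \<in> B \<and> Z \<omega> \<in> C}"
    by (auto simp: three)
  ultimately show ?thesis
    by (simp add: three vimage_def Int_def conj_commute mult.assoc)
qed

section \<open>Solving the congruence for \<open>z\<close> and the resulting probability\<close>

lemma square_plus_four_mult_cong_iff:
  fixes a b r :: int
  assumes "odd b" "a\<^sup>2 mod 4 = r mod 4"
  obtains g where "0 \<le> g" "g < 2 ^ m"
    "\<And>c. (a\<^sup>2 + 4 * b * c) mod 2 ^ (m + 2) = r mod 2 ^ (m + 2) \<longleftrightarrow> c mod 2 ^ m = g"
proof -
  obtain s where s: "r - a\<^sup>2 = 4 * s"
    using assms(2) by (metis mod_eq_dvd_iff dvdE)
  have coprime: "coprime b (2 ^ m)"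
    using assms(1) by (simp add: coprime_commute)
  \<comment> \<open>After division by 4 the congruence reads \<open>b * c = s\<close> modulo
    \<open>2 ^ m\<close>. With \<open>h\<close> the inverse of \<open>b\<close>, its only solution
    class is that of \<open>h * s\<close>.\<close>
  then obtain h where h: "[b * h = 1] (mod 2 ^ m)"
    using cong_solve_coprime_int by blast
  have "(a\<^sup>2 + 4 * b * c) mod 2 ^ (m + 2) = r mod 2 ^ (m + 2) \<longleftrightarrow> c mod 2 ^ m = (h * s) mod 2 ^ m" for c
  proof -
    have "a\<^sup>2 + 4 * b * c - r = 4 * (b * c - s)"
      using s by (simp add: algebra_simps)
    then have "(a\<^sup>2 + 4 * b * c) mod 2 ^ (m + 2) = r mod 2 ^ (m + 2) \<longleftrightarrow>
        4 * 2 ^ m dvd 4 * (b * c - s)"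
      by (simp only: mod_eq_dvd_iff power_add) (simp add: mult.commute)
    also have "\<dots> \<longleftrightarrow> [b * c = s] (mod 2 ^ m)"
      by (simp only: cong_iff_dvd_diff dvd_mult_cancel_left) simp
    also have "\<dots> \<longleftrightarrow> [b * c = b * (h * s)] (mod 2 ^ m)"
      using cong_scalar_right[OF h, of s] by (auto simp: cong_def mult.assoc)
    also have "\<dots> \<longleftrightarrow> c mod 2 ^ m = (h * s) mod 2 ^ m"
      using coprime by (simp add: cong_mult_lcancel) (simp add: cong_def)
    finally show ?thesis .
  qed
  then show ?thesis
    by (intro that[of "(h * s) mod 2 ^ m"]) auto
qed

lemma square_mod_4: "(a :: int)\<^sup>2 mod 4 = a mod 2"
proof (cases "even a")
  case True
  then show ?thesis
    by (auto simp: power2_eq_square)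
next
  case False
  then obtain q where "a = 2 * q + 1"
    by (rule oddE)
  then have "a\<^sup>2 = 1 + 4 * (q\<^sup>2 + q)"
    by (simp add: power2_eq_square algebra_simps)
  then show ?thesis
    using False by (simp only: mod_mult_self2) (simp add: odd_iff_mod_2_eq_one)
qed

lemma prob_residue_square_plus_four_mult:
  fixes M :: "'w measure" and \<alpha> y z :: "'w \<Rightarrow> two_adic" and r :: int
  assumes "prob_space M"
    and \<alpha>: "haar_random M UNIV (+) \<alpha>"
    and z: "haar_random M UNIV (+) z"
    and unit: "\<And>\<omega>. \<omega> \<in> space M \<Longrightarrow> is_unit (y \<omega>)"
    and indep: "prob_space.indep_vars M (\<lambda>_. borel) (\<lambda>i. [\<alpha>, z, y] ! i) {..<3}"
  shows "measure M {\<omega> \<in> space M. residue ((\<alpha> \<omega>)\<^sup>2 + 4 * y \<omega> * z \<omega>) (m + 2) = r mod 2 ^ (m + 2)} =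
    (if r mod 4 < 2 then 1 / 2 ^ (m + 1) else 0)"
proof -
  interpret prob_space M by fact
  define N where "N = m + 2"
  \<comment> \<open>The pairs of residues of \<open>\<alpha>\<close> and \<open>y\<close> for which
    a suitable \<open>z\<close> exists; \<open>odd b\<close> reflects that \<open>y\<close> is a
    unit. The set is empty when \<open>r\<close> is 2 or 3 modulo 4.\<close>
  define I :: "(int \<times> int) set" where "I = {(a, b). a \<in> {0..<2 ^ N} \<and> b \<in> {0..<2 ^ N} \<and> a\<^sup>2 mod 4 = r mod 4 \<and> odd b}"
  define X where "X = (\<lambda>(a, b). {\<omega> \<in> space M. residue (\<alpha> \<omega>) N = a \<and> residue (y \<omega>) N = b})"
  define E where "E = {\<omega> \<in> space M. residue ((\<alpha> \<omega>)\<^sup>2 + 4 * y \<omega> * z \<omega>) N = r mod 2 ^ N}"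
  have rv [measurable]: "\<alpha> \<in> borel_measurable M" "z \<in> borel_measurable M" "y \<in> borel_measurable M"
    using indep by (auto simp: indep_vars_def2 numeral_3_eq_3 lessThan_Suc)
  have residue_D: "residue (a\<^sup>2 + 4 * b * c) N =
      ((residue a N)\<^sup>2 + 4 * residue b N * residue c N) mod 2 ^ N" for a b c
    by (simp add: plus_two_adic.rep_eq times_two_adic.rep_eq power2_eq_square residue_numeral mod_simps)
  have E: "E = {\<omega> \<in> space M. ((residue (\<alpha> \<omega>) N)\<^sup>2 + 4 * residue (y \<omega>) N * residue (z \<omega>) N) mod 2 ^ N
      = r mod 2 ^ N}"
    by (simp add: E_def residue_D)
  have E_sets: "E \<in> sets M"
    unfolding E by measurable
  have X_sets: "X i \<in> sets M" for i
    unfolding X_def by (cases i) simp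
  have fin: "finite I"
    by (rule finite_subset[of _ "{0..<2 ^ N} \<times> {0..<2 ^ N}"]) (auto simp: I_def)
  \<comment> \<open>Modulo 4 the term \<open>4 * b * c\<close> vanishes, so an outcome in
    \<open>E\<close> has its pair of residues in \<open>I\<close>.\<close>
  have "4 dvd (2 :: int) ^ N"
    by (simp add: N_def power_add)
  then have mod4: "a\<^sup>2 mod 4 = r mod 4" if "(a\<^sup>2 + 4 * b * c) mod 2 ^ N = r mod 2 ^ N" for a b c :: int
    using that by (metis mod_mod_cancel mod_mult_self2 mult.assoc)
  have odd_y: "odd (residue (y \<omega>) N)" if "\<omega> \<in> space M" for \<omega>
    using unit[OF that] two_power_dvd_iff[of 1 "y \<omega>"] residue_mod_le[of 1 N "y \<omega>"]
    by (auto simp: two_adic_is_unit_iff N_def even_iff_mod_2_eq_zero)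
  \<comment> \<open>Once the pair is fixed, \<open>E\<close> prescribes \<open>z\<close> modulo
    \<open>2 ^ m\<close> only, two binary digits fewer than \<open>N\<close>, because of the factor
    4. The factors for \<open>\<alpha>\<close> and \<open>y\<close> are the same with and without
    \<open>E\<close>.\<close>
  have step: "prob (X i \<inter> E) = prob (X i) * (1 / 2 ^ m)" if i: "i \<in> I" for i
  proof -
    obtain a b where i_eq: "i = (a, b)" and ab: "odd b" "a\<^sup>2 mod 4 = r mod 4"
      using i by (auto simp: I_def)
    from square_plus_four_mult_cong_iff[OF ab] obtain g where g: "0 \<le> g" "g < 2 ^ m"
      "\<And>c. (a\<^sup>2 + 4 * b * c) mod 2 ^ (m + 2) = r mod 2 ^ (m + 2) \<longleftrightarrow> c mod 2 ^ m = g" by metis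
    let ?A = "{x. residue x N = a}" and ?B = "{x. residue x N = b}" and ?C = "{x. residue x m = g}"
    have sets: "?A \<in> sets borel" "?B \<in> sets borel" "?C \<in> sets borel"
      by measurable
    have "X i \<inter> E = {\<omega> \<in> space M. \<alpha> \<omega> \<in> ?A \<and> z \<omega> \<in> ?C \<and> y \<omega> \<in> ?B}"
      using g(3) residue_mod_le[of m N] unfolding E by (auto simp: X_def i_eq N_def)
    then have "prob (X i \<inter> E) =
        prob {\<omega> \<in> space M. \<alpha> \<omega> \<in> ?A} * prob {\<omega> \<in> space M. z \<omega> \<in> ?C} * prob {\<omega> \<in> space M. y \<omega> \<in> ?B}"
      using indep_vars_3D[OF indep sets(1,3,2)] by simp
    moreover have "X i = {\<omega> \<in> space M. \<alpha> \<omega> \<in> ?A \<and> z \<omega> \<in> UNIV \<and> y \<omega> \<in> ?B}"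
      by (auto simp: X_def i_eq)
    then have "prob (X i) = prob {\<omega> \<in> space M. \<alpha> \<omega> \<in> ?A} * prob {\<omega> \<in> space M. y \<omega> \<in> ?B}"
      using indep_vars_3D[OF indep sets(1) _ sets(2), of UNIV] by (simp add: prob_space)
    ultimately show ?thesis
      using haar_random_residue[OF z g(1,2)] by simp
  qed
  have disj: "disjoint_family_on X I"
    by (auto simp: disjoint_family_on_def X_def)
  have union: "(\<Union>i\<in>I. X i) = {\<omega> \<in> space M. (residue (\<alpha> \<omega>) N)\<^sup>2 mod 4 = r mod 4}"
    using residue_bounds odd_y by (auto simp: I_def X_def)
  have "E = (\<Union>i\<in>I. X i \<inter> E)"
    using union mod4 unfolding E by blast
  then have "prob E = prob (\<Union>i\<in>I. X i \<inter> E)"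
    by simp
  also have "\<dots> = (\<Sum>i\<in>I. prob (X i \<inter> E))"
    using fin X_sets E_sets
    by (intro finite_measure_finite_Union) (auto simp: disjoint_family_on_def X_def)
  also have "\<dots> = (\<Sum>i\<in>I. prob (X i)) * (1 / 2 ^ m)"
    using step by (simp add: sum_divide_distrib)
  also have "(\<Sum>i\<in>I. prob (X i)) = prob (\<Union>i\<in>I. X i)"
    using fin X_sets disj by (intro finite_measure_finite_Union[symmetric]) auto
  \<comment> \<open>Since \<open>y\<close> is always odd, only the parity of \<open>\<alpha>\<close>
    remains. It is 0 or 1, so the event is empty if \<open>r mod 4\<close> is 2 or 3.\<close>
  also have "(\<Union>i\<in>I. X i) = {\<omega> \<in> space M. residue (\<alpha> \<omega>) 1 = r mod 4}"
    unfolding union using residue_mod_le[of 1 N] by (auto simp: square_mod_4 N_def)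
  also have "prob \<dots> = (if r mod 4 < 2 then 1 / 2 else 0)"
  proof (cases "r mod 4 < 2")
    case True
    then show ?thesis
      using haar_random_residue[OF \<alpha>, of "r mod 4" 1] by simp
  next
    case False
    then have "residue x 1 \<noteq> r mod 4" for x
      using residue_bounds(2)[of x 1] by auto
    then show ?thesis
      using False by simp
  qed
  finally show ?thesis
    by (simp add: E_def N_def)
qed

theorem theorem6p3:
  fixes M :: "'w measure" and \<alpha> y z :: "'w \<Rightarrow> two_adic" and k :: nat
  assumes "prob_space M"
    and "haar_random M UNIV (+) \<alpha>"
    and "haar_random M UNIV (+) z"
    and "haar_random M {u. is_unit u} (*) y"
    and "prob_space.indep_vars M (\<lambda>_. borel) (\<lambda>i. [\<alpha>, z, y] ! i) {..<3}"
  shows "let D = (\<lambda>\<omega>. (\<alpha> \<omega>)\<^sup>2 + 4 * y \<omega> * z \<omega>);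
             Pr = (\<lambda>i m. measure M {\<omega> \<in> space M. D \<omega> \<noteq> 0 \<and> multiplicity 2 (D \<omega>) = k \<and> [sqf (D \<omega>) \<equiv> i] (modulo m)})
         in (Pr 1 8 = Pr 5 8 \<and> Pr 1 8 = (if odd k then 0 else 1 / 2 ^ (k + 2))) \<and>
            Pr 3 4 = (if odd k \<or> k = 0 then 0 else 1 / 2 ^ (k + 1)) \<and>
            Pr 2 4 = (if even k \<or> k = 1 then 0 else 1 / 2 ^ k)"
proof -
  define D where "D = (\<lambda>\<omega>. (\<alpha> \<omega>)\<^sup>2 + 4 * y \<omega> * z \<omega>)"
  define Pr where "Pr = (\<lambda>i m. measure M {\<omega> \<in> space M. D \<omega> \<noteq> 0 \<and> multiplicity 2 (D \<omega>) = k \<and>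
    [sqf (D \<omega>) \<equiv> i] (modulo m)})"
  have "y \<in> space M \<rightarrow> {u. is_unit u}"
    using assms(4) measurable_space[of y M "restrict_space borel {u. is_unit u}"]
    by (auto simp: haar_random_def space_restrict_space)
  then have unit: "is_unit (y \<omega>)" if "\<omega> \<in> space M" for \<omega>
    using that by blast
  have prob_residue: "measure M {\<omega> \<in> space M. residue (D \<omega>) (m + 2) = r mod 2 ^ (m + 2)} =
      (if r mod 4 < 2 then 1 / 2 ^ (m + 1) else 0)" for m r
    using prob_residue_square_plus_four_mult[OF assms(1-3) unit assms(5), of m r] by (simp only: D_def)
  have pow4: "(2 :: int) ^ k mod 4 = 0" if "k \<ge> 2"
    using le_imp_power_dvd[OF that, of "2 :: int"] by simp
  have pow_mult4: "2 ^ k * i mod 4 = (0 :: int)" if "k \<ge> 2" for i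
    using pow4[OF that] by (metis mod_mult_left_eq mult_zero_left mod_0)
  \<comment> \<open>Here \<open>r = 2 ^ k * i\<close> and \<open>m = k + j\<close>. For even
    \<open>k > 0\<close>, \<open>r\<close> is divisible by 4 and the congruence is solvable with
    \<open>\<alpha>\<close> even; for \<open>k = 0\<close> solvability depends on \<open>i\<close>
    modulo 4.\<close>
  have odd_case: "Pr (of_int i) (2 ^ (j + 2)) =
      (if odd k \<or> k = 0 \<and> i mod 4 \<ge> 2 then 0 else 1 / 2 ^ (k + j + 1))" if "odd i" for i j
  proof (cases "even k")
    case True
    have "Pr (of_int i) (2 ^ (j + 2)) =
        measure M {\<omega> \<in> space M. residue (D \<omega>) (k + j + 2) = 2 ^ k * i mod 2 ^ (k + j + 2)}"
      using sqf_cong_odd_iff_residue[OF that, of "j + 2"] True by (simp add: Pr_def add.assoc)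
    also have "\<dots> = (if 2 ^ k * i mod 4 < 2 then 1 / 2 ^ (k + j + 1) else 0)"
      by (rule prob_residue)
    also have "\<dots> = (if odd k \<or> k = 0 \<and> i mod 4 \<ge> 2 then 0 else 1 / 2 ^ (k + j + 1))"
    proof (cases "k = 0")
      case False
      with True have "k \<ge> 2"
        by presburger
      then show ?thesis
        using True pow_mult4[of i] by simp
    qed simp
    finally show ?thesis .
  next
    case False
    then show ?thesis
      using sqf_cong_odd_iff_residue[OF that, of "j + 2"] by (simp add: Pr_def)
  qed
  have "Pr 2 4 = (if even k \<or> k = 1 then 0 else 1 / 2 ^ k)"
  proof (cases "odd k")
    case True
    \<comment> \<open>The modulus is \<open>2 ^ Suc k\<close>, so \<open>m = k - 1\<close>. For
      \<open>k = 1\<close> this gives \<open>r = 2\<close>, which is not a square modulo 4; for odd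
      \<open>k \<ge> 3\<close>, 4 divides \<open>r\<close>.\<close>
    then have "k - 1 + 2 = Suc k" "k - 1 + 1 = k"
      by (auto elim: oddE)
    then show ?thesis
      using True prob_residue[of "k - 1" "2 ^ k"] pow4
      by (cases "k = 1") (auto simp: Pr_def sqf_cong_2_mod_4_iff_residue elim: oddE)
  next
    case False
    then show ?thesis
      by (simp add: Pr_def sqf_cong_2_mod_4_iff_residue)
  qed
  moreover have "Pr 1 8 = (if odd k then 0 else 1 / 2 ^ (k + 2))"
    "Pr 5 8 = (if odd k then 0 else 1 / 2 ^ (k + 2))"
    "Pr 3 4 = (if odd k \<or> k = 0 then 0 else 1 / 2 ^ (k + 1))"
    \<comment> \<open>Modulus 8 is \<open>j = 1\<close> and modulus 4 is \<open>j = 0\<close>. Both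
      1 and 5 are squares modulo 4, whereas 3 is not, whence the exception at
      \<open>k = 0\<close>.\<close>
    using odd_case[of 1 1] odd_case[of 5 1] odd_case[of 3 0] by simp_all
  ultimately show ?thesis
    by (simp add: Let_def Pr_def D_def)
qed

end
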